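(* Let $(\Omega,\mathcal F,P)$ be a probability space, $\Theta\subset\mathbb R^n$, and let $\mathbf T$ be a finite set of functions $\tau:\Theta\times\Omega\to\mathbb R$ with $\mathbf T\subset\mathcal D$. Suppose that for every $\theta\in\Theta$ the random variables $\tau(\theta,\cdot)$, $\tau\in\mathbf T$, are continuous and (mutually) independent. Then $[\mathbf T]_{\mathcal A}\subset\mathcal D$.
   Context: The class $\mathcal D$ (for the given $\Theta$ and $(\Omega,\mathcal F,P)$) consists of all functions $f:\Theta\times\Omega\to\mathbb R$ such that $f(\theta,\cdot)$ is $\mathcal F$-measurable for every $\theta\in\Theta$ and: (i) for every $\theta\in\Theta$, with probability 1 the derivative (gradient) $\partial f(\theta,\omega)/\partial\theta$ of $f(\cdot,\omega)$, as a function on $\Theta$, exists at $\theta$; (ii) there is a random variable $\lambda$ on $(\Omega,\mathcal F,P)$ with $E\lambda<\infty$ such that, with probability 1, $|f(\theta_1,\omega)-f(\theta_2,\omega)|\le\lambda(\omega)\|\theta_1-\theta_2\|$ for all $\theta_1,\theta_2\in\Theta$. $\mathcal A$ denotes the algebra of all functions $f:\Theta\times\Omega\to\mathbb R$ such that $f(\theta,\cdot)$ is a random variable on $(\Omega,\mathcal F,P)$ for every $\theta\in\Theta$, with the pointwise operations $\vee$ (maximum), $\wedge$ (minimum) and $+$. For a finite $\mathbf T\subset\mathcal A$, $[\mathbf T]_{\mathcal A}$ is the set generated by $\mathbf T$ in $\mathcal A$, i.e. the set of all functions obtained from elements of $\mathbf T$ by (finitely many applications of) the operations $\vee$, $\wedge$,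 $+$. A random variable $X$ is called continuous if its distribution function is continuous, i.e. $P(X=c)=0$ for all $c\in\mathbb R$. *)

theory Defs
  imports "HOL-Probability.Probability"
begin

text \<open>
  Functions on \<open>\<Theta> \<times> \<Omega>\<close> are total curried functions on
  \<open>\<real>\<^sup>n\<close> and the underlying type of the probability space; only their values on
  \<open>\<Theta>\<close> and \<open>space M\<close> matter for membership in the classes below.
\<close>

definition random_functions ::
    "'a measure \<Rightarrow> (real ^ 'n) set \<Rightarrow> (real ^ 'n \<Rightarrow> 'a \<Rightarrow> real) set" where
  "random_functions M \<Theta> = {f. \<forall>\<theta>\<in>\<Theta>. f \<theta> \<in> borel_measurable M}"

definition class_D ::
    "'a measure \<Rightarrow> (real ^ 'n) set \<Rightarrow> (real ^ 'n \<Rightarrow> 'a \<Rightarrow> real) set" where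
  "class_D M \<Theta> = {f \<in> random_functions M \<Theta>.
     (\<forall>\<theta>\<in>\<Theta>. AE \<omega> in M. (\<lambda>t. f t \<omega>) differentiable (at \<theta> within \<Theta>)) \<and>
     (\<exists>l. integrable M l \<and>
        (AE \<omega> in M. \<forall>\<theta>\<^sub>1\<in>\<Theta>. \<forall>\<theta>\<^sub>2\<in>\<Theta>.
            \<bar>f \<theta>\<^sub>1 \<omega> - f \<theta>\<^sub>2 \<omega>\<bar> \<le> l \<omega> * norm (\<theta>\<^sub>1 - \<theta>\<^sub>2)))}"

inductive_set generated ::
    "('t \<Rightarrow> 'a \<Rightarrow> real) set \<Rightarrow> ('t \<Rightarrow> 'a \<Rightarrow> real) set"
  for T :: "('t \<Rightarrow> 'a \<Rightarrow> real) set" where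
  base: "\<tau> \<in> T \<Longrightarrow> \<tau> \<in> generated T"
| max: "f \<in> generated T \<Longrightarrow> g \<in> generated T \<Longrightarrow>
    (\<lambda>\<theta> \<omega>. max (f \<theta> \<omega>) (g \<theta> \<omega>)) \<in> generated T"
| min: "f \<in> generated T \<Longrightarrow> g \<in> generated T \<Longrightarrow>
    (\<lambda>\<theta> \<omega>. min (f \<theta> \<omega>) (g \<theta> \<omega>)) \<in> generated T"
| add: "f \<in> generated T \<Longrightarrow> g \<in> generated T \<Longrightarrow>
    (\<lambda>\<theta> \<omega>. f \<theta> \<omega> + g \<theta> \<omega>) \<in> generated T"

lemma generated_subset_random_functions:
  assumes "T \<subseteq> random_functions M \<Theta>"
  shows "generated T \<subseteq> random_functions M \<Theta>"
proof
  fix f assume "f \<in> generated T"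
  then show "f \<in> random_functions M \<Theta>"
    using assms by induction
      (auto simp: random_functions_def intro!: borel_measurable_max borel_measurable_min borel_measurable_add)
qed

definition continuous_rv :: "'a measure \<Rightarrow> ('a \<Rightarrow> real) \<Rightarrow> bool" where
  "continuous_rv M X \<longleftrightarrow>
     X \<in> borel_measurable M \<and> continuous_on UNIV (cdf (distr M borel X))"

lemma continuous_rv_iff:
  assumes "prob_space M"
  shows "continuous_rv M X \<longleftrightarrow>
    X \<in> borel_measurable M \<and> (\<forall>c. measure M {\<omega> \<in> space M. X \<omega> = c} = 0)"
proof (cases "X \<in> borel_measurable M")
  case True
  interpret M: prob_space M by fact
  interpret D: real_distribution "distr M borel X"
    using True by (rule M.real_distribution_distr)
  have "measure (distr M borel X) {c} = measure M {\<omega> \<in> space M. X \<omega> = c}" for c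
    using True by (subst measure_distr) (auto intro!: arg_cong[where f = "measure M"])
  then show ?thesis
    using True by (simp add: continuous_rv_def continuous_on_eq_continuous_at D.isCont_cdf)
qed (simp add: continuous_rv_def)

end

theory Submission
  imports Defs
begin

text \<open>
  Fix \<open>\<theta>\<close>. A nontrivial integer combination of the \<open>\<tau>(\<theta>, \<cdot>)\<close> vanishes with probability 0: a
  summand with nonzero coefficient is continuous and independent of the rest. There are countably
  many combinations, so almost surely any two distinct combinations take distinct values at
  \<open>\<theta>\<close>. For such \<open>\<omega>\<close> every maximum or minimum formed on the way to a generated function
  is attained strictly at \<open>\<theta>\<close> (or between identical combinations), so by continuity
  the generated function coincides near \<open>\<theta>\<close> with a single combination and inherits its
  differentiability. The Lipschitz condition is preserved by all three operations.
\<close>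

text \<open>Independence makes the joint law of \<open>X\<close> and \<open>Y\<close> the product of
  their laws. By Fubini the diagonal is then null as soon as each of its sections
  \<open>X = y\<close> is null, so only \<open>X\<close> has to be continuous and \<open>Y\<close>
  is arbitrary.\<close>

lemma (in prob_space) indep_var_AE_neq:
  fixes X Y :: "'a \<Rightarrow> real"
  assumes indep: "indep_var borel X borel Y"
    and X: "\<And>c. measure M {\<omega> \<in> space M. X \<omega> = c} = 0"
  shows "AE \<omega> in M. X \<omega> \<noteq> Y \<omega>"
proof -
  have rv[measurable]: "X \<in> borel_measurable M" "Y \<in> borel_measurable M"
    using indep_var_rv1[OF indep] indep_var_rv2[OF indep] by auto
  interpret DX: prob_space "distr M borel X" by (rule prob_space_distr) fact
  interpret DY: prob_space "distr M borel Y" by (rule prob_space_distr) fact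
  interpret P: pair_sigma_finite "distr M borel X" "distr M borel Y" ..
  have "{p \<in> space (borel \<Otimes>\<^sub>M borel). fst p \<noteq> (snd p :: real)} \<in> sets (borel \<Otimes>\<^sub>M borel)"
    by measurable
  then have [measurable]: "{p. fst p \<noteq> (snd p :: real)} \<in> sets (borel \<Otimes>\<^sub>M borel)"
    by (simp add: space_pair_measure)
  have "AE x in distr M borel X. x \<noteq> y" for y
  proof -
    have "AE \<omega> in M. X \<omega> \<noteq> y"
      by (rule AE_I[where N="{\<omega> \<in> space M. X \<omega> = y}"]) (auto simp: emeasure_eq_measure X)
    then show ?thesis
      by (subst AE_distr_iff) auto
  qed
  \<comment> \<open>The null sections are those with \<open>y\<close> fixed, whereas
    \<open>P.AE_pair_measure\<close> integrates over \<open>y\<close> first; hence the exchange of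
    quantifiers.\<close>
  then have "AE x in distr M borel X. AE y in distr M borel Y. x \<noteq> y"
    by (subst P.AE_commute) (auto simp: space_pair_measure)
  then have "AE p in distr M borel X \<Otimes>\<^sub>M distr M borel Y. fst p \<noteq> snd p"
    by (intro P.AE_pair_measure) (auto simp: space_pair_measure)
  then have "AE p in distr M (borel \<Otimes>\<^sub>M borel) (\<lambda>\<omega>. (X \<omega>, Y \<omega>)). fst p \<noteq> snd p"
    using indep unfolding indep_var_distribution_eq by metis
  then show ?thesis
    by (subst (asm) AE_distr_iff) auto
qed

lemma (in prob_space) indep_continuous_combination_AE_nonzero:
  fixes X :: "'i \<Rightarrow> 'a \<Rightarrow> real" and c :: "'i \<Rightarrow> real"
  assumes "finite I"
    and indep: "indep_vars (\<lambda>_. borel) X I"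
    and cont: "\<And>i. i \<in> I \<Longrightarrow> continuous_rv M (X i)"
    and j: "j \<in> I" "c j \<noteq> 0"
  shows "AE \<omega> in M. (\<Sum>i\<in>I. c i * X i \<omega>) \<noteq> 0"
proof -
  define Z where "Z = (\<lambda>i \<omega>. c i * X i \<omega>)"
  have "indep_vars (\<lambda>_. borel) Z I"
    unfolding Z_def by (rule indep_vars_compose2[OF indep]) simp
  then have "indep_vars (\<lambda>_. borel) Z (insert j (I - {j}))"
    using j by (simp add: insert_absorb)
  then have "indep_var borel (Z j) borel (\<lambda>\<omega>. \<Sum>i\<in>I - {j}. Z i \<omega>)"
    using \<open>finite I\<close> by (intro indep_vars_sum) auto
  \<comment> \<open>Negating the remaining sum turns the vanishing of the whole combination into a
    coincidence of two independent variables.\<close>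
  then have "indep_var borel ((\<lambda>x. x) \<circ> Z j) borel (uminus \<circ> (\<lambda>\<omega>. \<Sum>i\<in>I - {j}. Z i \<omega>))"
    by (rule indep_var_compose) auto
  moreover have "measure M {\<omega> \<in> space M. Z j \<omega> = a} = 0" for a
  proof -
    have "{\<omega> \<in> space M. Z j \<omega> = a} = {\<omega> \<in> space M. X j \<omega> = a / c j}"
      using j by (auto simp: Z_def field_simps)
    then show ?thesis
      using cont[OF j(1)] continuous_rv_iff[OF prob_space_axioms] by auto
  qed
  ultimately have "AE \<omega> in M. Z j \<omega> \<noteq> - (\<Sum>i\<in>I - {j}. Z i \<omega>)"
    using indep_var_AE_neq by (fastforce simp: o_def)
  then show ?thesis
    by eventually_elim (use j \<open>finite I\<close> in \<open>simp add: Z_def sum.remove eq_neg_iff_add_eq_0\<close>)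
qed

text \<open>The difference of two combinations is one with integer coefficients, not all zero. A
  countable union of null sets handles all pairs at once, which puts the quantifier over
  coefficients inside the \<open>AE\<close>.\<close>

lemma (in prob_space) indep_continuous_AE_distinct_combinations:
  fixes X :: "'i \<Rightarrow> 'a \<Rightarrow> real"
  assumes "finite I"
    and "indep_vars (\<lambda>_. borel) X I"
    and "\<And>i. i \<in> I \<Longrightarrow> continuous_rv M (X i)"
  shows "AE \<omega> in M. \<forall>a b :: 'i \<Rightarrow> nat. (\<exists>i\<in>I. a i \<noteq> b i) \<longrightarrow>
    (\<Sum>i\<in>I. real (a i) * X i \<omega>) \<noteq> (\<Sum>i\<in>I. real (b i) * X i \<omega>)"
proof -
  \<comment> \<open>Coefficients are taken extensional on the finite set \<open>I\<close>, since the
    functions on the whole type \<open>'i\<close> may be uncountable.\<close>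
  define C :: "('i \<Rightarrow> int) set" where "C = {c \<in> I \<rightarrow>\<^sub>E UNIV. \<exists>i\<in>I. c i \<noteq> 0}"
  have "countable C"
    by (rule countable_subset[OF _ countable_PiE[OF \<open>finite I\<close>, of "\<lambda>_. UNIV"]])
      (auto simp: C_def)
  moreover have "AE \<omega> in M. (\<Sum>i\<in>I. of_int (c i) * X i \<omega>) \<noteq> 0" if "c \<in> C" for c
    using that indep_continuous_combination_AE_nonzero[OF assms, of _ "\<lambda>i. of_int (c i)"]
    by (auto simp: C_def)
  ultimately have "AE \<omega> in M. \<forall>c\<in>C. (\<Sum>i\<in>I. of_int (c i) * X i \<omega>) \<noteq> 0"
    by (simp add: AE_ball_countable)
  then show ?thesis
  proof (rule AE_mp, intro AE_I2 impI allI)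
    fix \<omega> and a b :: "'i \<Rightarrow> nat"
    assume nz: "\<forall>c\<in>C. (\<Sum>i\<in>I. of_int (c i) * X i \<omega>) \<noteq> 0"
      and ab: "\<exists>i\<in>I. a i \<noteq> b i"
    define c where "c = restrict (\<lambda>i. int (a i) - int (b i)) I"
    have "c \<in> C"
      using ab by (auto simp: C_def c_def)
    moreover have "(\<Sum>i\<in>I. of_int (c i) * X i \<omega>) =
        (\<Sum>i\<in>I. real (a i) * X i \<omega>) - (\<Sum>i\<in>I. real (b i) * X i \<omega>)"
      by (simp add: c_def sum_subtractf[symmetric] left_diff_distrib)
    ultimately show "(\<Sum>i\<in>I. real (a i) * X i \<omega>) \<noteq> (\<Sum>i\<in>I. real (b i) * X i \<omega>)"
      using nz by auto
  qed
qed

text \<open>This part is deterministic, with \<open>\<omega>\<close> fixed. Natural coefficients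
  suffice because sums are the only arithmetic involved. The value at \<open>\<theta>\<close> is
  carried through the induction separately: the filter \<open>at \<theta> within \<Theta>\<close>
  omits \<open>\<theta>\<close> itself.\<close>

lemma generated_locally_combination:
  fixes T :: "('t::t2_space \<Rightarrow> 'a \<Rightarrow> real) set"
  assumes "f \<in> generated T" and "finite T"
    and cont: "\<And>\<tau>. \<tau> \<in> T \<Longrightarrow> continuous (at \<theta> within \<Theta>) (\<lambda>t. \<tau> t \<omega>)"
    and dist: "\<And>a b :: ('t \<Rightarrow> 'a \<Rightarrow> real) \<Rightarrow> nat. \<exists>\<tau>\<in>T. a \<tau> \<noteq> b \<tau> \<Longrightarrow>
      (\<Sum>\<tau>\<in>T. real (a \<tau>) * \<tau> \<theta> \<omega>) \<noteq> (\<Sum>\<tau>\<in>T. real (b \<tau>) * \<tau> \<theta> \<omega>)"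
  shows "\<exists>a :: ('t \<Rightarrow> 'a \<Rightarrow> real) \<Rightarrow> nat. f \<theta> \<omega> = (\<Sum>\<tau>\<in>T. real (a \<tau>) * \<tau> \<theta> \<omega>) \<and>
    (\<forall>\<^sub>F t in at \<theta> within \<Theta>. f t \<omega> = (\<Sum>\<tau>\<in>T. real (a \<tau>) * \<tau> t \<omega>))"
proof -
  define L where "L = (\<lambda>(a :: ('t \<Rightarrow> 'a \<Rightarrow> real) \<Rightarrow> nat) t. \<Sum>\<tau>\<in>T. real (a \<tau>) * \<tau> t \<omega>)"
  have L_tendsto: "(L a \<longlongrightarrow> L a \<theta>) (at \<theta> within \<Theta>)" for a
    unfolding L_def using cont by (intro tendsto_intros) (auto simp: continuous_within)
  \<comment> \<open>If the coefficients agree on \<open>T\<close>, the two combinations are the same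
    function. Otherwise \<open>dist\<close> separates them at \<open>\<theta>\<close>, and the
    strict inequality persists nearby because the difference tends to a positive limit.\<close>
  have L_cases: "L a = L b
      \<or> L a \<theta> < L b \<theta> \<and> (\<forall>\<^sub>F t in at \<theta> within \<Theta>. L a t < L b t)
      \<or> L b \<theta> < L a \<theta> \<and> (\<forall>\<^sub>F t in at \<theta> within \<Theta>. L b t < L a t)" for a b
  proof (cases "\<exists>\<tau>\<in>T. a \<tau> \<noteq> b \<tau>")
    case True
    then have "L a \<theta> < L b \<theta> \<or> L b \<theta> < L a \<theta>"
      using dist[of a b] unfolding L_def by linarith
    then show ?thesis
      using
        tendsto_diff[OF L_tendsto[of b] L_tendsto[of a], THEN order_tendstoD(1), of 0]
        tendsto_diff[OF L_tendsto[of a] L_tendsto[of b], THEN order_tendstoD(1), of 0]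
      by auto
  qed (auto simp: L_def)
  have "\<exists>a. f \<theta> \<omega> = L a \<theta> \<and> (\<forall>\<^sub>F t in at \<theta> within \<Theta>. f t \<omega> = L a t)"
    using assms(1)
  proof induction
    case (base \<tau>)
    \<comment> \<open>A single generator is the combination whose coefficient vector is the
      indicator of that generator.\<close>
    have "L (\<lambda>\<sigma>. if \<sigma> = \<tau> then 1 else 0) = (\<lambda>t. \<tau> t \<omega>)"
      using base \<open>finite T\<close> by (simp add: L_def if_distrib[of real] mult_if_delta sum.delta cong: if_cong)
    then show ?case
      by (intro exI[of _ "\<lambda>\<sigma>. if \<sigma> = \<tau> then 1 else 0"]) auto
  next
    case (max f g)
    then obtain a b where
        a: "f \<theta> \<omega> = L a \<theta>" "\<forall>\<^sub>F t in at \<theta> within \<Theta>. f t \<omega> = L a t"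
      and b: "g \<theta> \<omega> = L b \<theta>" "\<forall>\<^sub>F t in at \<theta> within \<Theta>. g t \<omega> = L b t"
      by blast
    consider "L a = L b"
      | "L a \<theta> < L b \<theta>" "\<forall>\<^sub>F t in at \<theta> within \<Theta>. L a t < L b t"
      | "L b \<theta> < L a \<theta>" "\<forall>\<^sub>F t in at \<theta> within \<Theta>. L b t < L a t"
      using L_cases[of a b] by blast
    then show ?case
    proof cases
      case 1
      with a b show ?thesis
        by (intro exI[of _ a]) (auto elim: eventually_elim2)
    next
      case 2
      from 2(2) a(2) b(2) have "\<forall>\<^sub>F t in at \<theta> within \<Theta>. max (f t \<omega>) (g t \<omega>) = L b t"
        by eventually_elim auto
      with 2 a b show ?thesis by (intro exI[of _ b]) auto
    next
      case 3
      from 3(2) a(2) b(2) have "\<forall>\<^sub>F t in at \<theta> within \<Theta>. max (f t \<omega>) (g t \<omega>) = L a t"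
        by eventually_elim auto
      with 3 a b show ?thesis by (intro exI[of _ a]) auto
    qed
  next
    case (min f g)
    then obtain a b where
        a: "f \<theta> \<omega> = L a \<theta>" "\<forall>\<^sub>F t in at \<theta> within \<Theta>. f t \<omega> = L a t"
      and b: "g \<theta> \<omega> = L b \<theta>" "\<forall>\<^sub>F t in at \<theta> within \<Theta>. g t \<omega> = L b t"
      by blast
    consider "L a = L b"
      | "L a \<theta> < L b \<theta>" "\<forall>\<^sub>F t in at \<theta> within \<Theta>. L a t < L b t"
      | "L b \<theta> < L a \<theta>" "\<forall>\<^sub>F t in at \<theta> within \<Theta>. L b t < L a t"
      using L_cases[of a b] by blast
    then show ?case
    proof cases
      case 1
      with a b show ?thesis
        by (intro exI[of _ a]) (auto elim: eventually_elim2)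
    next
      case 2
      from 2(2) a(2) b(2) have "\<forall>\<^sub>F t in at \<theta> within \<Theta>. min (f t \<omega>) (g t \<omega>) = L a t"
        by eventually_elim auto
      with 2 a b show ?thesis by (intro exI[of _ a]) auto
    next
      case 3
      from 3(2) a(2) b(2) have "\<forall>\<^sub>F t in at \<theta> within \<Theta>. min (f t \<omega>) (g t \<omega>) = L b t"
        by eventually_elim auto
      with 3 a b show ?thesis by (intro exI[of _ b]) auto
    qed
  next
    case (add f g)
    then obtain a b where
        a: "f \<theta> \<omega> = L a \<theta>" "\<forall>\<^sub>F t in at \<theta> within \<Theta>. f t \<omega> = L a t"
      and b: "g \<theta> \<omega> = L b \<theta>" "\<forall>\<^sub>F t in at \<theta> within \<Theta>. g t \<omega> = L b t"
      by blast
    have "L (\<lambda>\<tau>. a \<tau> + b \<tau>) t = L a t + L b t" for t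
      by (simp add: L_def sum.distrib distrib_right)
    with a b show ?case
      by (intro exI[of _ "\<lambda>\<tau>. a \<tau> + b \<tau>"]) (auto elim: eventually_elim2)
  qed
  then show ?thesis
    by (simp add: L_def)
qed

text \<open>Agreement near \<open>x\<close> is agreement on a punctured neighbourhood, so equality
  at \<open>x\<close> has to be a separate premise.\<close>

lemma differentiable_transform_eventually:
  assumes "x \<in> S" and "g differentiable (at x within S)"
    and "\<forall>\<^sub>F t in at x within S. f t = g t" and "f x = g x"
  shows "f differentiable (at x within S)"
proof -
  obtain g' where "(g has_derivative g') (at x within S)"
    using assms(2) by (auto simp: differentiable_def)
  then have "(f has_derivative g') (at x within S)"
    by (rule has_derivative_transform_eventually) (use assms in \<open>auto simp: eq_commute\<close>)
  then show ?thesis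
    by (auto simp: differentiable_def)
qed

text \<open>An increment of a maximum, minimum or sum is at most the sum of the increments of its
  two arguments. Hence the Lipschitz bounds of the arguments add up, and their sum is again
  integrable; \<open>combine\<close> treats the three operations together.\<close>

lemma generated_integrable_Lipschitz:
  fixes T :: "('t::real_normed_vector \<Rightarrow> 'a \<Rightarrow> real) set"
  assumes "f \<in> generated T"
    and "\<And>\<tau>. \<tau> \<in> T \<Longrightarrow> \<exists>l. integrable M l \<and> (AE \<omega> in M. \<forall>x\<in>\<Theta>. \<forall>y\<in>\<Theta>.
      \<bar>\<tau> x \<omega> - \<tau> y \<omega>\<bar> \<le> l \<omega> * norm (x - y))"
  shows "\<exists>l. integrable M l \<and> (AE \<omega> in M. \<forall>x\<in>\<Theta>. \<forall>y\<in>\<Theta>.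
      \<bar>f x \<omega> - f y \<omega>\<bar> \<le> l \<omega> * norm (x - y))"
proof -
  have combine: "\<exists>l. integrable M l \<and> (AE \<omega> in M. \<forall>x\<in>\<Theta>. \<forall>y\<in>\<Theta>.
      \<bar>h x \<omega> - h y \<omega>\<bar> \<le> l \<omega> * norm (x - y))"
    if f: "\<exists>l. integrable M l \<and> (AE \<omega> in M. \<forall>x\<in>\<Theta>. \<forall>y\<in>\<Theta>. \<bar>f x \<omega> - f y \<omega>\<bar> \<le> l \<omega> * norm (x - y))"
      and g: "\<exists>l. integrable M l \<and> (AE \<omega> in M. \<forall>x\<in>\<Theta>. \<forall>y\<in>\<Theta>. \<bar>g x \<omega> - g y \<omega>\<bar> \<le> l \<omega> * norm (x - y))"
      and h: "\<And>x y \<omega>. \<bar>h x \<omega> - h y \<omega>\<bar> \<le> \<bar>f x \<omega> - f y \<omega>\<bar> + \<bar>g x \<omega> - g y \<omega>\<bar>"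
    for f g h :: "'t \<Rightarrow> 'a \<Rightarrow> real"
  proof -
    obtain l k where
        l: "integrable M l" "AE \<omega> in M. \<forall>x\<in>\<Theta>. \<forall>y\<in>\<Theta>. \<bar>f x \<omega> - f y \<omega>\<bar> \<le> l \<omega> * norm (x - y)"
      and k: "integrable M k" "AE \<omega> in M. \<forall>x\<in>\<Theta>. \<forall>y\<in>\<Theta>. \<bar>g x \<omega> - g y \<omega>\<bar> \<le> k \<omega> * norm (x - y)"
      using f g by blast
    from l(2) k(2) have "AE \<omega> in M. \<forall>x\<in>\<Theta>. \<forall>y\<in>\<Theta>. \<bar>h x \<omega> - h y \<omega>\<bar> \<le> (l \<omega> + k \<omega>) * norm (x - y)"
    proof eventually_elim
      case (elim \<omega>)
      show ?case
      proof (intro ballI)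
        fix x y assume "x \<in> \<Theta>" "y \<in> \<Theta>"
        then have "\<bar>f x \<omega> - f y \<omega>\<bar> \<le> l \<omega> * norm (x - y)" "\<bar>g x \<omega> - g y \<omega>\<bar> \<le> k \<omega> * norm (x - y)"
          using elim by auto
        then show "\<bar>h x \<omega> - h y \<omega>\<bar> \<le> (l \<omega> + k \<omega>) * norm (x - y)"
          using h[of x \<omega> y] by (simp add: distrib_right)
      qed
    qed
    with l(1) k(1) show ?thesis
      by (intro exI[of _ "\<lambda>\<omega>. l \<omega> + k \<omega>"]) auto
  qed
  show ?thesis
    using assms(1)
  proof induction
    case (base \<tau>)
    then show ?case by (rule assms(2))
  next
    case (max f g)
    from max.IH show ?case by (rule combine) auto
  next
    case (min f g)
    from min.IH show ?case by (rule combine) auto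
  next
    case (add f g)
    from add.IH show ?case by (rule combine) auto
  qed
qed

theorem theorem11:
  fixes M :: "'a measure"
    and \<Theta> :: "(real ^ 'n) set"
    and T :: "(real ^ 'n \<Rightarrow> 'a \<Rightarrow> real) set"
  assumes "prob_space M"
    and "finite T"
    and "T \<subseteq> class_D M \<Theta>"
    and "\<And>\<theta> \<tau>. \<theta> \<in> \<Theta> \<Longrightarrow> \<tau> \<in> T \<Longrightarrow> continuous_rv M (\<tau> \<theta>)"
    and "\<And>\<theta>. \<theta> \<in> \<Theta> \<Longrightarrow> prob_space.indep_vars M (\<lambda>_. borel) (\<lambda>\<tau>. \<tau> \<theta>) T"
  shows "generated T \<subseteq> class_D M \<Theta>"
proof
  fix f assume f: "f \<in> generated T"
  interpret prob_space M by fact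
  have "f \<in> random_functions M \<Theta>"
    using generated_subset_random_functions[of T M \<Theta>] f assms(3) by (auto simp: class_D_def)
  moreover have "AE \<omega> in M. (\<lambda>t. f t \<omega>) differentiable (at \<theta> within \<Theta>)" if "\<theta> \<in> \<Theta>" for \<theta>
  proof -
    \<comment> \<open>Finiteness of \<open>T\<close> gives one null set, depending on
      \<open>\<theta>\<close>, outside which all generators are differentiable at
      \<open>\<theta>\<close>.\<close>
    have "AE \<omega> in M. \<forall>\<tau>\<in>T. (\<lambda>t. \<tau> t \<omega>) differentiable (at \<theta> within \<Theta>)"
      using assms(2,3) that by (intro AE_finite_allI) (auto simp: class_D_def)
    moreover have "AE \<omega> in M. \<forall>a b :: _ \<Rightarrow> nat. (\<exists>\<tau>\<in>T. a \<tau> \<noteq> b \<tau>) \<longrightarrow>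
        (\<Sum>\<tau>\<in>T. real (a \<tau>) * \<tau> \<theta> \<omega>) \<noteq> (\<Sum>\<tau>\<in>T. real (b \<tau>) * \<tau> \<theta> \<omega>)"
      using assms(2,4,5) that by (intro indep_continuous_AE_distinct_combinations) auto
    ultimately show ?thesis
    proof eventually_elim
      case (elim \<omega>)
      obtain a :: "(real ^ 'n \<Rightarrow> 'a \<Rightarrow> real) \<Rightarrow> nat" where
          a: "f \<theta> \<omega> = (\<Sum>\<tau>\<in>T. real (a \<tau>) * \<tau> \<theta> \<omega>)"
            "\<forall>\<^sub>F t in at \<theta> within \<Theta>. f t \<omega> = (\<Sum>\<tau>\<in>T. real (a \<tau>) * \<tau> t \<omega>)"
        \<comment> \<open>Differentiability of the generators at \<open>\<theta>\<close> supplies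
          the continuity on which the local representation rests.\<close>
        using generated_locally_combination[OF f assms(2), of \<theta> \<Theta> \<omega>] elim
          differentiable_imp_continuous_within by blast
      have "(\<lambda>t. \<Sum>\<tau>\<in>T. real (a \<tau>) * \<tau> t \<omega>) differentiable (at \<theta> within \<Theta>)"
        using elim(1) assms(2) by (intro differentiable_sum differentiable_mult) auto
      then show ?case
        by (rule differentiable_transform_eventually[OF that]) (use a in auto)
    qed
  qed
  moreover have "\<exists>l. integrable M l \<and> (AE \<omega> in M. \<forall>x\<in>\<Theta>. \<forall>y\<in>\<Theta>.
      \<bar>f x \<omega> - f y \<omega>\<bar> \<le> l \<omega> * norm (x - y))"
    using f by (rule generated_integrable_Lipschitz) (use assms(3) in \<open>auto simp: class_D_def\<close>)
  ultimately show "f \<in> class_D M \<Theta>"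
    by (auto simp: class_D_def)
qed

end
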